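(* Let ${}_R G$ be a module. For each prime $p$ that divides $|G|$, there exist a finite field $\mathbb{F}$ of characteristic $p$ and a positive integer $t$ such that the module ${}_{M_t(\mathbb{F})}\mathbb{F}^t$ fractionally dominates ${}_R G$.
   Context: Rings are associative with identity $1$, not necessarily commutative. A module ${}_R G$ is a left (unital) $R$-module $G$ whose underlying Abelian group $G$ is finite; the ring $R$ need not be finite. $M_t(\mathbb{F})$ is the ring of $t\times t$ matrices over $\mathbb{F}$, and ${}_{M_t(\mathbb{F})}\mathbb{F}^t$ is the module in which it acts on column vectors in $\mathbb{F}^t$ by matrix-vector multiplication. A network is a finite directed acyclic multigraph, some of whose nodes are sources or receivers, with finitely many message vectors (say $m$ of them), each originating at a source node; each receiver demands a specified set of the message vectors. The inputs of a node are the message vectors originating at the node together with the vectors carried by its incoming edges. For integers $k_1,\dots,k_m\ge 0$ and $n\ge 1$, a $(k_1,\dots,k_m,n)$ code over a finite alphabet $\mathcal{A}$ (with $|\mathcal{A}|\ge 2$) lets the $i$th message vector range over $\mathcal{A}^{k_i}$, assigns to each edge an edge function mapping the inputs of the edge's tail node to a vector in $\mathcal{A}^n$ (the vector carried by the edge), and assigns to each receiver and each message vector it demands a decoding function of the receiver's inputs. The code is a solution if, for all values of the message vectors, each decoding function outputs the demanded message vector. A code over the alphabet $\mathcal{A}=G$ is linear over the module ${}_R G$ if every edge function and decoding function is of the form $\mathbf{x}\mapsto A\mathbf{x}$, where $\mathbf{x}$ is the concatenation (a vector over $G$) of the input vectors of the node, $A$ is a matrix with entries in $R$, and entries of $A$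 multiply entries of $\mathbf{x}$ via the module action. A module ${}_S H$ fractionally dominates a module ${}_R G$ if for all integers $k_1,\dots,k_m\ge 0$ and $n\ge 1$, every network with a $(k_1,\dots,k_m,n)$ linear solution over ${}_R G$ also has a $(k_1,\dots,k_m,n)$ linear solution over ${}_S H$. *)

theory Defs
  imports
    "HOL-Algebra.Multiplicative_Group"
    "HOL-Computational_Algebra.Primes"
    "Jordan_Normal_Form.Matrix"
    "Graph_Theory.Digraph"
begin

section \<open>Left modules over non-commutative rings\<close>

text \<open>The locale \<open>module\<close> of HOL-Algebra requires a commutative ring of scalars; the following one
  has the same axioms over an arbitrary ring.\<close>

locale left_module = R?: ring R + M?: abelian_group M
  for R :: "('r, 'x) ring_scheme" (structure) and M :: "('r, 'g, 'm) module_scheme" (structure) +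
  assumes smult_closed [simp, intro]:
      "\<lbrakk>a \<in> carrier R; x \<in> carrier M\<rbrakk> \<Longrightarrow> a \<odot>\<^bsub>M\<^esub> x \<in> carrier M"
    and smult_l_distr:
      "\<lbrakk>a \<in> carrier R; b \<in> carrier R; x \<in> carrier M\<rbrakk> \<Longrightarrow>
       (a \<oplus> b) \<odot>\<^bsub>M\<^esub> x = a \<odot>\<^bsub>M\<^esub> x \<oplus>\<^bsub>M\<^esub> b \<odot>\<^bsub>M\<^esub> x"
    and smult_r_distr:
      "\<lbrakk>a \<in> carrier R; x \<in> carrier M; y \<in> carrier M\<rbrakk> \<Longrightarrow>
       a \<odot>\<^bsub>M\<^esub> (x \<oplus>\<^bsub>M\<^esub> y) = a \<odot>\<^bsub>M\<^esub> x \<oplus>\<^bsub>M\<^esub> a \<odot>\<^bsub>M\<^esub> y"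
    and smult_assoc1:
      "\<lbrakk>a \<in> carrier R; b \<in> carrier R; x \<in> carrier M\<rbrakk> \<Longrightarrow>
       (a \<otimes> b) \<odot>\<^bsub>M\<^esub> x = a \<odot>\<^bsub>M\<^esub> (b \<odot>\<^bsub>M\<^esub> x)"
    and smult_one [simp]:
      "x \<in> carrier M \<Longrightarrow> \<one> \<odot>\<^bsub>M\<^esub> x = x"

text \<open>The additive order of the identity; \<open>group.ord\<close> is \<open>0\<close> for elements of infinite order.\<close>

definition ring_char :: "('a, 'x) ring_scheme \<Rightarrow> nat" where
  "ring_char R = group.ord (add_monoid R) \<one>\<^bsub>R\<^esub>"

text \<open>The ring \<open>M\<^sub>t(F)\<close> and the module \<open>F\<^sup>t\<close> over it. The ring operations on \<open>'a mat\<close> and \<open>'a vec\<close>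
  are those of a type class, so they are spelled out here for a ring \<open>F\<close> with
  explicit carrier. See \<open>ring.ring_matrix_ring\<close> and \<open>ring.left_module_column_module\<close> below.\<close>

definition matrix_ring :: "('a, 'x) ring_scheme \<Rightarrow> nat \<Rightarrow> 'a mat ring" where
  "matrix_ring F t =
    \<lparr>carrier = {A \<in> carrier_mat t t. elements_mat A \<subseteq> carrier F},
     monoid.mult = (\<lambda>A B. mat t t (\<lambda>(i, j). \<Oplus>\<^bsub>F\<^esub>l\<in>{..<t}. A $$ (i, l) \<otimes>\<^bsub>F\<^esub> B $$ (l, j))),
     one = mat t t (\<lambda>(i, j). if i = j then \<one>\<^bsub>F\<^esub> else \<zero>\<^bsub>F\<^esub>),
     zero = mat t t (\<lambda>_. \<zero>\<^bsub>F\<^esub>),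
     add = (\<lambda>A B. mat t t (\<lambda>(i, j). A $$ (i, j) \<oplus>\<^bsub>F\<^esub> B $$ (i, j)))\<rparr>"

text \<open>The record type \<open>module\<close> extends \<open>ring\<close>; the fields \<open>mult\<close> and \<open>one\<close> play no role in a module.\<close>

definition column_module :: "('a, 'x) ring_scheme \<Rightarrow> nat \<Rightarrow> ('a mat, 'a vec) module" where
  "column_module F t =
    \<lparr>carrier = {x \<in> carrier_vec t. vec_set x \<subseteq> carrier F},
     monoid.mult = undefined,
     one = undefined,
     zero = vec t (\<lambda>_. \<zero>\<^bsub>F\<^esub>),
     add = (\<lambda>x y. vec t (\<lambda>i. x $ i \<oplus>\<^bsub>F\<^esub> y $ i)),
     smult = (\<lambda>A x. vec t (\<lambda>i. \<Oplus>\<^bsub>F\<^esub>j\<in>{..<t}. A $$ (i, j) \<otimes>\<^bsub>F\<^esub> x $ j))\<rparr>"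


section \<open>Networks\<close>

text \<open>Nodes and edges are natural numbers, which is no restriction for a finite multigraph. The
  messages are indexed by \<open>0, \<dots>, num_messages - 1\<close>. The sources are the nodes at which some message
  originates, and the receivers are the nodes that demand some message.\<close>

record network =
  dag :: "(nat, nat) pre_digraph"
  num_messages :: nat
  origin :: "nat \<Rightarrow> nat"
  demands :: "nat \<Rightarrow> nat set"

locale network = fin_digraph "dag N" for N :: network +
  assumes acyclic: "acyclic (arcs_ends (dag N))"
    and origin: "i < num_messages N \<Longrightarrow> origin N i \<in> verts (dag N)"
    and demands: "v \<in> verts (dag N) \<Longrightarrow> demands N v \<subseteq> {..<num_messages N}"

definition messages_at :: "network \<Rightarrow> nat \<Rightarrow> nat list" where
  "messages_at N v = filter (\<lambda>i. origin N i = v) [0..<num_messages N]"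

definition in_edges :: "network \<Rightarrow> nat \<Rightarrow> nat list" where
  "in_edges N v = sorted_list_of_set (in_arcs (dag N) v)"

text \<open>The list of inputs of a node, given the message vectors \<open>x\<close> and the vectors \<open>c\<close> carried by the
  edges.\<close>

definition inputs :: "network \<Rightarrow> (nat \<Rightarrow> 'a) \<Rightarrow> (nat \<Rightarrow> 'a) \<Rightarrow> nat \<Rightarrow> 'a list" where
  "inputs N x c v = map x (messages_at N v) @ map c (in_edges N v)"


section \<open>Codes\<close>

text \<open>Vectors over an alphabet are lists, so that the concatenation of input vectors is \<open>concat\<close>.\<close>

definition words :: "'a set \<Rightarrow> nat \<Rightarrow> 'a list set" where
  "words A l = {xs \<in> lists A. length xs = l}"

definition input_dims :: "network \<Rightarrow> (nat \<Rightarrow> nat) \<Rightarrow> nat \<Rightarrow> nat \<Rightarrow> nat list" where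
  "input_dims N k n v = inputs N k (\<lambda>_. n) v"

definition input_space :: "network \<Rightarrow> 'a set \<Rightarrow> (nat \<Rightarrow> nat) \<Rightarrow> nat \<Rightarrow> nat \<Rightarrow> 'a list list set" where
  "input_space N A k n v = listset (map (words A) (input_dims N k n v))"

text \<open>\<open>edge_fun C e\<close> is the function of the edge \<open>e\<close>, and \<open>decode C v i\<close> is the decoding function of
  the receiver \<open>v\<close> for the message \<open>i\<close>.\<close>

record 'a code =
  edge_fun :: "nat \<Rightarrow> 'a list list \<Rightarrow> 'a list"
  decode :: "nat \<Rightarrow> nat \<Rightarrow> 'a list list \<Rightarrow> 'a list"

text \<open>The dimension \<open>k i\<close> of the message \<open>i\<close> only matters for \<open>i < num_messages N\<close>.\<close>

definition is_code ::
    "network \<Rightarrow> 'a set \<Rightarrow> (nat \<Rightarrow> nat) \<Rightarrow> nat \<Rightarrow> 'a code \<Rightarrow> bool" where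
  "is_code N A k n C \<longleftrightarrow>
    finite A \<and> card A \<ge> 2 \<and> n \<ge> 1 \<and>
    (\<forall>e\<in>arcs (dag N).
       edge_fun C e \<in> input_space N A k n (tail (dag N) e) \<rightarrow> words A n) \<and>
    (\<forall>v\<in>verts (dag N). \<forall>i\<in>demands N v.
       decode C v i \<in> input_space N A k n v \<rightarrow> words A (k i))"

text \<open>The vector carried by each edge, by recursion along the graph: \<open>d\<close> precedes \<open>e\<close> if \<open>d\<close> enters
  the tail of \<open>e\<close>. In a network, this relation is well-founded, and the recursion equation
  \<open>network.carried_eq\<close> below holds.\<close>

definition edge_prec :: "network \<Rightarrow> (nat \<times> nat) set" where
  "edge_prec N =
    {(d, e). d \<in> arcs (dag N) \<and> e \<in> arcs (dag N) \<and> head (dag N) d = tail (dag N) e}"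

definition carried :: "network \<Rightarrow> 'a code \<Rightarrow> (nat \<Rightarrow> 'a list) \<Rightarrow> nat \<Rightarrow> 'a list" where
  "carried N C x =
    wfrec (edge_prec N) (\<lambda>c e. edge_fun C e (inputs N x c (tail (dag N) e)))"

context network
begin

lemma wf_edge_prec: "wf (edge_prec N)"
proof (rule finite_acyclic_wf)
  have "edge_prec N \<subseteq> arcs (dag N) \<times> arcs (dag N)"
    by (auto simp: edge_prec_def)
  then show "finite (edge_prec N)"
    by (rule finite_subset) simp
  have "(tail (dag N) d, tail (dag N) e) \<in> (arcs_ends (dag N))\<^sup>+"
    if "(d, e) \<in> (edge_prec N)\<^sup>+" for d e
    using that
  proof (induction rule: trancl_induct)
    case (base e)
    then have "(tail (dag N) d, tail (dag N) e) \<in> arcs_ends (dag N)"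
      by (auto simp: edge_prec_def arcs_ends_conv)
    then show ?case by (rule r_into_trancl)
  next
    case (step e f)
    from step.hyps(2) have "(tail (dag N) e, tail (dag N) f) \<in> arcs_ends (dag N)"
      by (auto simp: edge_prec_def arcs_ends_conv)
    with step.IH show ?case by (rule trancl_into_trancl)
  qed
  then show "acyclic (edge_prec N)"
    using acyclic unfolding acyclic_def by blast
qed

lemma carried_eq:
  assumes "e \<in> arcs (dag N)"
  shows "carried N C x e = edge_fun C e (inputs N x (carried N C x) (tail (dag N) e))"
proof -
  have "finite (in_arcs (dag N) v)" for v
    by (rule finite_subset[OF _ finite_arcs]) (auto simp: in_arcs_def)
  then have "inputs N x (cut (carried N C x) (edge_prec N) e) (tail (dag N) e) =
      inputs N x (carried N C x) (tail (dag N) e)"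
    using assms by (auto simp: inputs_def in_edges_def in_arcs_def cut_def edge_prec_def)
  then show ?thesis
    unfolding carried_def by (subst wfrec[OF wf_edge_prec]) simp
qed

end

definition is_solution ::
    "network \<Rightarrow> 'a set \<Rightarrow> (nat \<Rightarrow> nat) \<Rightarrow> nat \<Rightarrow> 'a code \<Rightarrow> bool" where
  "is_solution N A k n C \<longleftrightarrow>
    is_code N A k n C \<and>
    (\<forall>x. (\<forall>i<num_messages N. x i \<in> words A (k i)) \<longrightarrow>
       (\<forall>v\<in>verts (dag N). \<forall>i\<in>demands N v.
          decode C v i (inputs N x (carried N C x) v) = x i))"


section \<open>Linear codes and fractional dominance\<close>

definition mat_app :: "('r, 'g, 'm) module_scheme \<Rightarrow> 'r mat \<Rightarrow> 'g list \<Rightarrow> 'g list" where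
  "mat_app G A x =
    map (\<lambda>i. \<Oplus>\<^bsub>G\<^esub>j\<in>{..<dim_col A}. A $$ (i, j) \<odot>\<^bsub>G\<^esub> x ! j) [0..<dim_row A]"

text \<open>Linearity of a function \<open>f\<close> of input vectors of lengths \<open>ds\<close> with values of length \<open>l\<close>.\<close>

definition linear_fun ::
    "('r, 'x) ring_scheme \<Rightarrow> ('r, 'g, 'm) module_scheme \<Rightarrow>
     nat list \<Rightarrow> nat \<Rightarrow> ('g list list \<Rightarrow> 'g list) \<Rightarrow> bool" where
  "linear_fun R G ds l f \<longleftrightarrow>
    (\<exists>A \<in> carrier_mat l (sum_list ds). elements_mat A \<subseteq> carrier R \<and>
       (\<forall>xs \<in> listset (map (words (carrier G)) ds). f xs = mat_app G A (concat xs)))"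

definition is_linear_code ::
    "network \<Rightarrow> ('r, 'x) ring_scheme \<Rightarrow> ('r, 'g, 'm) module_scheme \<Rightarrow>
     (nat \<Rightarrow> nat) \<Rightarrow> nat \<Rightarrow> 'g code \<Rightarrow> bool" where
  "is_linear_code N R G k n C \<longleftrightarrow>
    is_code N (carrier G) k n C \<and>
    (\<forall>e\<in>arcs (dag N). linear_fun R G (input_dims N k n (tail (dag N) e)) n (edge_fun C e)) \<and>
    (\<forall>v\<in>verts (dag N). \<forall>i\<in>demands N v.
       linear_fun R G (input_dims N k n v) (k i) (decode C v i))"

definition has_linear_solution ::
    "network \<Rightarrow> ('r, 'x) ring_scheme \<Rightarrow> ('r, 'g, 'm) module_scheme \<Rightarrow>
     (nat \<Rightarrow> nat) \<Rightarrow> nat \<Rightarrow> bool" where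
  "has_linear_solution N R G k n \<longleftrightarrow>
    (\<exists>C. is_linear_code N R G k n C \<and> is_solution N (carrier G) k n C)"

text \<open>The module \<open>H\<close> over \<open>S\<close> fractionally dominates the module \<open>G\<close> over \<open>R\<close>.\<close>

definition fractionally_dominates ::
    "('s, 'y) ring_scheme \<Rightarrow> ('s, 'h, 'n) module_scheme \<Rightarrow>
     ('r, 'x) ring_scheme \<Rightarrow> ('r, 'g, 'm) module_scheme \<Rightarrow> bool" where
  "fractionally_dominates S H R G \<longleftrightarrow>
    (\<forall>k n N. n \<ge> 1 \<longrightarrow> network N \<longrightarrow>
       has_linear_solution N R G k n \<longrightarrow> has_linear_solution N S H k n)"


section \<open>The matrix ring and its column module are well-defined\<close>

context ring
begin

lemma matrix_ring_carrier_iff: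
  "A \<in> carrier (matrix_ring R t) \<longleftrightarrow>
     dim_row A = t \<and> dim_col A = t \<and> (\<forall>i<t. \<forall>j<t. A $$ (i, j) \<in> carrier R)"
proof -
  have "elements_mat A = {A $$ (i, j) | i j. i < dim_row A \<and> j < dim_col A}"
    by (auto dest!: elements_matD intro!: elements_matI[OF carrier_matI])
  then show ?thesis
    by (fastforce simp: matrix_ring_def)
qed

lemma column_module_carrier_iff:
  "x \<in> carrier (column_module R t) \<longleftrightarrow> dim_vec x = t \<and> (\<forall>i<t. x $ i \<in> carrier R)"
  by (auto simp: column_module_def vec_set_def image_subset_iff Ball_def)

lemma sum_product_assoc:
  fixes t :: nat
  assumes "\<And>l. l < t \<Longrightarrow> a l \<in> carrier R" "\<And>l m. \<lbrakk>l < t; m < t\<rbrakk> \<Longrightarrow> b l m \<in> carrier R"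
    and "\<And>m. m < t \<Longrightarrow> c m \<in> carrier R"
  shows "(\<Oplus>m\<in>{..<t}. (\<Oplus>l\<in>{..<t}. a l \<otimes> b l m) \<otimes> c m) =
    (\<Oplus>l\<in>{..<t}. a l \<otimes> (\<Oplus>m\<in>{..<t}. b l m \<otimes> c m))"
proof -
  have "(\<Oplus>m\<in>{..<t}. (\<Oplus>l\<in>{..<t}. a l \<otimes> b l m) \<otimes> c m) =
      (\<Oplus>m\<in>{..<t}. \<Oplus>l\<in>{..<t}. a l \<otimes> (b l m \<otimes> c m))"
    using assms by (intro finsum_cong') (auto simp: finsum_ldistr m_assoc Pi_def intro!: finsum_cong')
  also have "\<dots> = (\<Oplus>l\<in>{..<t}. \<Oplus>m\<in>{..<t}. a l \<otimes> (b l m \<otimes> c m))"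
    using assms by (intro finsum_finsum_swap) auto
  also have "\<dots> = (\<Oplus>l\<in>{..<t}. a l \<otimes> (\<Oplus>m\<in>{..<t}. b l m \<otimes> c m))"
    using assms by (intro finsum_cong') (auto simp: finsum_rdistr Pi_def)
  finally show ?thesis .
qed

lemma sum_delta_left:
  assumes "i < (t::nat)" "\<And>j. j < t \<Longrightarrow> f j \<in> carrier R"
  shows "(\<Oplus>j\<in>{..<t}. (if i = j then \<one> else \<zero>) \<otimes> f j) = f i"
proof -
  have "(\<Oplus>j\<in>{..<t}. (if i = j then \<one> else \<zero>) \<otimes> f j) =
      (\<Oplus>j\<in>{..<t}. if i = j then f j else \<zero>)"
    using assms by (intro finsum_cong') auto
  also have "\<dots> = f i"
    using assms by (intro finsum_singleton) auto
  finally show ?thesis .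
qed

lemma sum_delta_right:
  assumes "i < (t::nat)" "\<And>j. j < t \<Longrightarrow> f j \<in> carrier R"
  shows "(\<Oplus>j\<in>{..<t}. f j \<otimes> (if j = i then \<one> else \<zero>)) = f i"
proof -
  have "(\<Oplus>j\<in>{..<t}. f j \<otimes> (if j = i then \<one> else \<zero>)) =
      (\<Oplus>j\<in>{..<t}. if i = j then f j else \<zero>)"
    using assms by (intro finsum_cong') auto
  also have "\<dots> = f i"
    using assms by (intro finsum_singleton) auto
  finally show ?thesis .
qed

lemma sum_distr_left:
  assumes "\<And>l. l < (t::nat) \<Longrightarrow> a l \<in> carrier R" "\<And>l. l < t \<Longrightarrow> b l \<in> carrier R"
    "\<And>l. l < t \<Longrightarrow> c l \<in> carrier R"
  shows "(\<Oplus>l\<in>{..<t}. (a l \<oplus> b l) \<otimes> c l) =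
    (\<Oplus>l\<in>{..<t}. a l \<otimes> c l) \<oplus> (\<Oplus>l\<in>{..<t}. b l \<otimes> c l)"
proof -
  have "(\<Oplus>l\<in>{..<t}. (a l \<oplus> b l) \<otimes> c l) = (\<Oplus>l\<in>{..<t}. a l \<otimes> c l \<oplus> b l \<otimes> c l)"
    using assms by (intro finsum_cong') (auto simp: l_distr)
  then show ?thesis
    using assms by (simp add: finsum_addf Pi_def)
qed

lemma sum_distr_right:
  assumes "\<And>l. l < (t::nat) \<Longrightarrow> a l \<in> carrier R" "\<And>l. l < t \<Longrightarrow> b l \<in> carrier R"
    "\<And>l. l < t \<Longrightarrow> c l \<in> carrier R"
  shows "(\<Oplus>l\<in>{..<t}. c l \<otimes> (a l \<oplus> b l)) =
    (\<Oplus>l\<in>{..<t}. c l \<otimes> a l) \<oplus> (\<Oplus>l\<in>{..<t}. c l \<otimes> b l)"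
proof -
  have "(\<Oplus>l\<in>{..<t}. c l \<otimes> (a l \<oplus> b l)) = (\<Oplus>l\<in>{..<t}. c l \<otimes> a l \<oplus> c l \<otimes> b l)"
    using assms by (intro finsum_cong') (auto simp: r_distr)
  then show ?thesis
    using assms by (simp add: finsum_addf Pi_def)
qed

lemma sum_index_cong:
  assumes "\<And>l. l < (t::nat) \<Longrightarrow> f l = g l" "\<And>l. l < t \<Longrightarrow> g l \<in> carrier R"
  shows "(\<Oplus>l\<in>{..<t}. f l) = (\<Oplus>l\<in>{..<t}. g l)"
  using assms by (intro finsum_cong') auto

lemma matrix_ring_ops:
  "\<And>A B. A \<otimes>\<^bsub>matrix_ring R t\<^esub> B =
     mat t t (\<lambda>(i, j). \<Oplus>l\<in>{..<t}. A $$ (i, l) \<otimes> B $$ (l, j))"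
  "\<And>A B. A \<oplus>\<^bsub>matrix_ring R t\<^esub> B = mat t t (\<lambda>(i, j). A $$ (i, j) \<oplus> B $$ (i, j))"
  "\<one>\<^bsub>matrix_ring R t\<^esub> = mat t t (\<lambda>(i, j). if i = j then \<one> else \<zero>)"
  "\<zero>\<^bsub>matrix_ring R t\<^esub> = mat t t (\<lambda>_. \<zero>)"
  by (auto simp: matrix_ring_def)

lemma column_module_ops:
  "\<And>A x. A \<odot>\<^bsub>column_module R t\<^esub> x = vec t (\<lambda>i. \<Oplus>j\<in>{..<t}. A $$ (i, j) \<otimes> x $ j)"
  "\<And>x y. x \<oplus>\<^bsub>column_module R t\<^esub> y = vec t (\<lambda>i. x $ i \<oplus> y $ i)"
  "\<zero>\<^bsub>column_module R t\<^esub> = vec t (\<lambda>_. \<zero>)"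
  by (auto simp: column_module_def)

lemma ring_matrix_ring: "ring (matrix_ring R t)"
proof (rule ringI)
  let ?M = "matrix_ring R t"
  note defs = matrix_ring_carrier_iff matrix_ring_ops
  show "abelian_group ?M"
  proof (rule abelian_groupI)
    show "\<exists>B\<in>carrier ?M. B \<oplus>\<^bsub>?M\<^esub> A = \<zero>\<^bsub>?M\<^esub>" if "A \<in> carrier ?M" for A
      using that
      by (intro bexI[of _ "mat t t (\<lambda>(i, j). \<ominus> A $$ (i, j))"])
        (auto simp: defs l_neg)
  qed (auto simp: defs a_assoc intro!: eq_matI a_comm)
  show "monoid ?M"
  proof (rule monoidI)
    fix A B C assume M: "A \<in> carrier ?M" "B \<in> carrier ?M" "C \<in> carrier ?M"
    show "A \<otimes>\<^bsub>?M\<^esub> B \<otimes>\<^bsub>?M\<^esub> C = A \<otimes>\<^bsub>?M\<^esub> (B \<otimes>\<^bsub>?M\<^esub> C)"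
    proof (rule eq_matI)
      fix i j assume "i < dim_row (A \<otimes>\<^bsub>?M\<^esub> (B \<otimes>\<^bsub>?M\<^esub> C))" "j < dim_col (A \<otimes>\<^bsub>?M\<^esub> (B \<otimes>\<^bsub>?M\<^esub> C))"
      then have ij: "i < t" "j < t" by (auto simp: defs)
      have "(A \<otimes>\<^bsub>?M\<^esub> B \<otimes>\<^bsub>?M\<^esub> C) $$ (i, j) =
          (\<Oplus>m\<in>{..<t}. (\<Oplus>l\<in>{..<t}. A $$ (i, l) \<otimes> B $$ (l, m)) \<otimes> C $$ (m, j))"
        using M ij by (auto simp: defs intro!: sum_index_cong)
      also have "\<dots> = (\<Oplus>l\<in>{..<t}. A $$ (i, l) \<otimes> (\<Oplus>m\<in>{..<t}. B $$ (l, m) \<otimes> C $$ (m, j)))"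
        using M ij by (intro sum_product_assoc) (auto simp: defs)
      also have "\<dots> = (A \<otimes>\<^bsub>?M\<^esub> (B \<otimes>\<^bsub>?M\<^esub> C)) $$ (i, j)"
        using M ij by (auto simp: defs intro!: sum_index_cong)
      finally show "(A \<otimes>\<^bsub>?M\<^esub> B \<otimes>\<^bsub>?M\<^esub> C) $$ (i, j) = (A \<otimes>\<^bsub>?M\<^esub> (B \<otimes>\<^bsub>?M\<^esub> C)) $$ (i, j)" .
    qed (auto simp: defs)
  next
    fix A assume M: "A \<in> carrier ?M"
    show "\<one>\<^bsub>?M\<^esub> \<otimes>\<^bsub>?M\<^esub> A = A"
    proof (rule eq_matI)
      fix i j assume ij: "i < dim_row A" "j < dim_col A"
      have "(\<one>\<^bsub>?M\<^esub> \<otimes>\<^bsub>?M\<^esub> A) $$ (i, j) = (\<Oplus>l\<in>{..<t}. (if i = l then \<one> else \<zero>) \<otimes> A $$ (l, j))"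
        using M ij by (auto simp: defs intro!: sum_index_cong)
      also have "\<dots> = A $$ (i, j)"
        using M ij by (intro sum_delta_left) (auto simp: defs)
      finally show "(\<one>\<^bsub>?M\<^esub> \<otimes>\<^bsub>?M\<^esub> A) $$ (i, j) = A $$ (i, j)" .
    qed (use M in \<open>auto simp: defs\<close>)
    show "A \<otimes>\<^bsub>?M\<^esub> \<one>\<^bsub>?M\<^esub> = A"
    proof (rule eq_matI)
      fix i j assume ij: "i < dim_row A" "j < dim_col A"
      have "(A \<otimes>\<^bsub>?M\<^esub> \<one>\<^bsub>?M\<^esub>) $$ (i, j) = (\<Oplus>l\<in>{..<t}. A $$ (i, l) \<otimes> (if l = j then \<one> else \<zero>))"
        using M ij by (auto simp: defs intro!: sum_index_cong)
      also have "\<dots> = A $$ (i, j)"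
        using M ij by (intro sum_delta_right) (auto simp: defs)
      finally show "(A \<otimes>\<^bsub>?M\<^esub> \<one>\<^bsub>?M\<^esub>) $$ (i, j) = A $$ (i, j)" .
    qed (use M in \<open>auto simp: defs\<close>)
  qed (auto simp: defs intro!: finsum_closed)
  fix A B C assume M: "A \<in> carrier ?M" "B \<in> carrier ?M" "C \<in> carrier ?M"
  show "(A \<oplus>\<^bsub>?M\<^esub> B) \<otimes>\<^bsub>?M\<^esub> C = A \<otimes>\<^bsub>?M\<^esub> C \<oplus>\<^bsub>?M\<^esub> B \<otimes>\<^bsub>?M\<^esub> C"
    using M by (intro eq_matI) (simp_all add: defs flip: sum_distr_left, auto intro!: sum_index_cong)
  show "C \<otimes>\<^bsub>?M\<^esub> (A \<oplus>\<^bsub>?M\<^esub> B) = C \<otimes>\<^bsub>?M\<^esub> A \<oplus>\<^bsub>?M\<^esub> C \<otimes>\<^bsub>?M\<^esub> B"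
    using M by (intro eq_matI) (simp_all add: defs flip: sum_distr_right, auto intro!: sum_index_cong)
qed

lemma left_module_column_module: "left_module (matrix_ring R t) (column_module R t)"
proof -
  let ?S = "matrix_ring R t" and ?V = "column_module R t"
  note defs = matrix_ring_carrier_iff matrix_ring_ops column_module_carrier_iff column_module_ops
  have group: "abelian_group ?V"
  proof (rule abelian_groupI)
    show "\<exists>y\<in>carrier ?V. y \<oplus>\<^bsub>?V\<^esub> x = \<zero>\<^bsub>?V\<^esub>" if "x \<in> carrier ?V" for x
      using that by (intro bexI[of _ "vec t (\<lambda>i. \<ominus> x $ i)"]) (auto simp: defs l_neg)
  qed (auto simp: defs a_assoc intro!: eq_vecI a_comm)
  show ?thesis
  proof (intro left_module.intro left_module_axioms.intro ring_matrix_ring group)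
    fix A B x y assume M: "A \<in> carrier ?S" "B \<in> carrier ?S" "x \<in> carrier ?V"
    show "(A \<oplus>\<^bsub>?S\<^esub> B) \<odot>\<^bsub>?V\<^esub> x = A \<odot>\<^bsub>?V\<^esub> x \<oplus>\<^bsub>?V\<^esub> B \<odot>\<^bsub>?V\<^esub> x"
      using M by (intro eq_vecI) (simp_all add: defs flip: sum_distr_left, auto intro!: sum_index_cong)
    show "(A \<otimes>\<^bsub>?S\<^esub> B) \<odot>\<^bsub>?V\<^esub> x = A \<odot>\<^bsub>?V\<^esub> (B \<odot>\<^bsub>?V\<^esub> x)"
    proof (rule eq_vecI)
      fix i assume "i < dim_vec (A \<odot>\<^bsub>?V\<^esub> (B \<odot>\<^bsub>?V\<^esub> x))"
      then have i: "i < t" by (auto simp: defs)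
      have "((A \<otimes>\<^bsub>?S\<^esub> B) \<odot>\<^bsub>?V\<^esub> x) $ i =
          (\<Oplus>m\<in>{..<t}. (\<Oplus>l\<in>{..<t}. A $$ (i, l) \<otimes> B $$ (l, m)) \<otimes> x $ m)"
        using M i by (auto simp: defs intro!: sum_index_cong)
      also have "\<dots> = (\<Oplus>l\<in>{..<t}. A $$ (i, l) \<otimes> (\<Oplus>m\<in>{..<t}. B $$ (l, m) \<otimes> x $ m))"
        using M i by (intro sum_product_assoc) (auto simp: defs)
      also have "\<dots> = (A \<odot>\<^bsub>?V\<^esub> (B \<odot>\<^bsub>?V\<^esub> x)) $ i"
        using M i by (auto simp: defs intro!: sum_index_cong)
      finally show "((A \<otimes>\<^bsub>?S\<^esub> B) \<odot>\<^bsub>?V\<^esub> x) $ i = (A \<odot>\<^bsub>?V\<^esub> (B \<odot>\<^bsub>?V\<^esub> x)) $ i" .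
    qed (auto simp: defs)
  next
    fix A x y assume M: "A \<in> carrier ?S" "x \<in> carrier ?V" "y \<in> carrier ?V"
    show "A \<odot>\<^bsub>?V\<^esub> (x \<oplus>\<^bsub>?V\<^esub> y) = A \<odot>\<^bsub>?V\<^esub> x \<oplus>\<^bsub>?V\<^esub> A \<odot>\<^bsub>?V\<^esub> y"
      using M by (intro eq_vecI) (simp_all add: defs flip: sum_distr_right, auto intro!: sum_index_cong)
  next
    fix x assume M: "x \<in> carrier ?V"
    show "\<one>\<^bsub>?S\<^esub> \<odot>\<^bsub>?V\<^esub> x = x"
    proof (rule eq_vecI)
      fix i assume i: "i < dim_vec x"
      have "(\<one>\<^bsub>?S\<^esub> \<odot>\<^bsub>?V\<^esub> x) $ i = (\<Oplus>j\<in>{..<t}. (if i = j then \<one> else \<zero>) \<otimes> x $ j)"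
        using M i by (auto simp: defs intro!: sum_index_cong)
      also have "\<dots> = x $ i"
        using M i by (intro sum_delta_left) (auto simp: defs)
      finally show "(\<one>\<^bsub>?S\<^esub> \<odot>\<^bsub>?V\<^esub> x) $ i = x $ i" .
    qed (use M in \<open>auto simp: defs\<close>)
  qed (auto simp: defs intro!: finsum_closed)
qed

end

end

theory Submission
  imports Defs "HOL-Algebra.Sylow" "HOL-Number_Theory.Cong"
begin

text \<open>By Cauchy's theorem, the \<open>p\<close>-torsion elements of \<open>G\<close> form a nonzero submodule \<open>T\<close>. It is a vector space
  over the prime field \<open>F\<close>, so \<open>T \<cong> F\<^sup>t\<close>, and each scalar \<open>r\<close> acts on it by some matrix \<open>\<rho> r\<close>.
  Replacing every \<open>r\<close> by \<open>\<rho> r\<close> in a linear code over \<open>G\<close> describes the restriction of the code to messages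
  over \<open>T\<close>, so it turns solutions into solutions.\<close>

section \<open>Input tuples and images of finite sums\<close>

lemma listset_iff: "xs \<in> listset As \<longleftrightarrow> list_all2 (\<in>) xs As"
  by (induction As arbitrary: xs) (auto simp: set_Cons_def list_all2_Cons2)

text \<open>By induction on finite \<open>I\<close>; for infinite \<open>I\<close> both sums are
  zero by convention. This carries \<open>\<phi>\<close>, scalars and endomorphisms through every
  sum below.\<close>

lemma (in abelian_group_hom) hom_finsum:
  assumes "f \<in> I \<rightarrow> carrier G"
  shows "h (finsum G f I) = finsum H (\<lambda>i. h (f i)) I"
  using assms
proof (induction I rule: infinite_finite_induct)
  case (insert i I)
  then have "(\<lambda>i. h (f i)) \<in> I \<rightarrow> carrier H" "h (f i) \<in> carrier H"
    by (auto simp: Pi_iff)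
  with insert show ?case
    by simp
qed simp_all

section \<open>Transfer of linear solutions\<close>

text \<open>The map \<open>\<phi>\<close> goes from \<open>H\<close> to \<open>G\<close>, against
  the direction in which solutions travel. \<open>\<rho>\<close> is a mere function: successive edge
  functions are compared through \<open>\<phi>\<close>, never as products of matrices, so
  compatibility for one scalar at a time suffices.\<close>

locale module_embedding =
  G: left_module R G + H: left_module S H + phi: abelian_group_hom H G \<phi>
  for R :: "('r, 'x) ring_scheme" and G :: "('r, 'g, 'm) module_scheme"
    and S :: "('s, 'y) ring_scheme" and H :: "('s, 'h, 'n) module_scheme"
    and \<phi> :: "'h \<Rightarrow> 'g" +
  fixes \<rho> :: "'r \<Rightarrow> 's"
  assumes inj: "inj_on \<phi> (carrier H)"
    and rho_closed: "r \<in> carrier R \<Longrightarrow> \<rho> r \<in> carrier S"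
    and semilinear:
      "\<lbrakk>r \<in> carrier R; h \<in> carrier H\<rbrakk> \<Longrightarrow> \<phi> (\<rho> r \<odot>\<^bsub>H\<^esub> h) = r \<odot>\<^bsub>G\<^esub> \<phi> h"
begin

text \<open>Each entry is a finite sum of scalar multiples; additivity of \<open>\<phi>\<close>
  handles the sum and \<open>semilinear\<close> each term.\<close>

lemma map_mat_app:
  assumes "elements_mat A \<subseteq> carrier R" "set x \<subseteq> carrier H" "length x = dim_col A"
  shows "map \<phi> (mat_app H (map_mat \<rho> A) x) = mat_app G A (map \<phi> x)"
    and "mat_app H (map_mat \<rho> A) x \<in> words (carrier H) (dim_row A)"
proof -
  have A: "A $$ (i, j) \<in> carrier R" if "i < dim_row A" "j < dim_col A" for i j
    using assms(1) that by (auto simp: elements_matI[OF carrier_matI])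
  have x: "x ! j \<in> carrier H" if "j < dim_col A" for j
    using assms that by (auto dest: nth_mem)
  have term_closed: "(\<lambda>j. map_mat \<rho> A $$ (i, j) \<odot>\<^bsub>H\<^esub> x ! j) \<in> {..<dim_col A} \<rightarrow> carrier H"
    if "i < dim_row A" for i
    using that A x by (auto simp: rho_closed)
  show "map \<phi> (mat_app H (map_mat \<rho> A) x) = mat_app G A (map \<phi> x)"
    using term_closed A x assms(3)
    by (auto simp: mat_app_def phi.hom_finsum semilinear intro!: G.M.finsum_cong')
  show "mat_app H (map_mat \<rho> A) x \<in> words (carrier H) (dim_row A)"
    using A x by (auto simp: mat_app_def words_def rho_closed intro!: H.M.finsum_closed)
qed

lemma map_words: "x \<in> words (carrier H) l \<Longrightarrow> map \<phi> x \<in> words (carrier G) l"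
  by (auto simp: words_def)

lemma map_input_words:
  "xs \<in> listset (map (words (carrier H)) ds) \<Longrightarrow>
     map (map \<phi>) xs \<in> listset (map (words (carrier G)) ds)"
  by (auto simp: listset_iff list_all2_map1 list_all2_map2 map_words elim: list_all2_mono)

lemma concat_input_words:
  "xs \<in> listset (map (words (carrier H)) ds) \<Longrightarrow>
     set (concat xs) \<subseteq> carrier H \<and> length (concat xs) = sum_list ds"
  by (induction ds arbitrary: xs) (fastforce simp: set_Cons_def words_def)+

text \<open>The lift applies \<open>\<rho>\<close> entrywise to the matrix of \<open>f\<close>. Edge
  functions and decoding functions can then be treated alike through the three properties of
  \<open>f'\<close>, without further mention of matrices.\<close>

lemma linear_fun_lift:
  assumes "linear_fun R G ds l f"
  obtains f' where "linear_fun S H ds l f'"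
    and "f' \<in> listset (map (words (carrier H)) ds) \<rightarrow> words (carrier H) l"
    and "\<And>xs. xs \<in> listset (map (words (carrier H)) ds) \<Longrightarrow> map \<phi> (f' xs) = f (map (map \<phi>) xs)"
proof -
  from assms obtain A where A: "A \<in> carrier_mat l (sum_list ds)" "elements_mat A \<subseteq> carrier R"
    and f: "\<And>xs. xs \<in> listset (map (words (carrier G)) ds) \<Longrightarrow> f xs = mat_app G A (concat xs)"
    by (auto simp: linear_fun_def)
  show thesis
  proof
    show "linear_fun S H ds l (\<lambda>xs. mat_app H (map_mat \<rho> A) (concat xs))"
      unfolding linear_fun_def using A
      by (intro bexI[of _ "map_mat \<rho> A"])
        (fastforce simp: rho_closed elements_mat_def)+
    show "(\<lambda>xs. mat_app H (map_mat \<rho> A) (concat xs))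
        \<in> listset (map (words (carrier H)) ds) \<rightarrow> words (carrier H) l"
      using A concat_input_words map_mat_app(2)[of A] by fastforce
    show "map \<phi> (mat_app H (map_mat \<rho> A) (concat xs)) = f (map (map \<phi>) xs)"
      if "xs \<in> listset (map (words (carrier H)) ds)" for xs
      using A that concat_input_words[OF that]
      by (simp add: f map_input_words map_mat_app(1) map_concat)
  qed
qed

text \<open>Under \<open>\<phi>\<close>, the lifted code on messages \<open>x\<close> runs exactly
  as the given code on the messages \<open>\<phi> x\<close>. The latter decodes to
  \<open>\<phi> x\<close>, and injectivity of \<open>\<phi>\<close> recovers
  \<open>x\<close>.\<close>

lemma has_linear_solution_lift:
  assumes H: "finite (carrier H)" "card (carrier H) \<ge> 2"
    and "network N" and sol: "has_linear_solution N R G k n"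
  shows "has_linear_solution N S H k n"
proof -
  interpret network N by fact
  let ?in = "\<lambda>v. listset (map (words (carrier H)) (input_dims N k n v))"
  from sol obtain C where lin: "is_linear_code N R G k n C" and C: "is_solution N (carrier G) k n C"
    by (auto simp: has_linear_solution_def)
  have "\<exists>f'. linear_fun S H (input_dims N k n (tail (dag N) e)) n f'
      \<and> f' \<in> ?in (tail (dag N) e) \<rightarrow> words (carrier H) n
      \<and> (\<forall>xs \<in> ?in (tail (dag N) e). map \<phi> (f' xs) = edge_fun C e (map (map \<phi>) xs))"
    if "e \<in> arcs (dag N)" for e
    using lin that linear_fun_lift[of "input_dims N k n (tail (dag N) e)" n "edge_fun C e"]
    unfolding is_linear_code_def by metis
  then obtain f' where f': "\<And>e. e \<in> arcs (dag N) \<Longrightarrow>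
      linear_fun S H (input_dims N k n (tail (dag N) e)) n (f' e)
      \<and> f' e \<in> ?in (tail (dag N) e) \<rightarrow> words (carrier H) n
      \<and> (\<forall>xs \<in> ?in (tail (dag N) e). map \<phi> (f' e xs) = edge_fun C e (map (map \<phi>) xs))"
    by metis
  have "\<exists>d'. linear_fun S H (input_dims N k n v) (k i) d'
      \<and> d' \<in> ?in v \<rightarrow> words (carrier H) (k i)
      \<and> (\<forall>xs \<in> ?in v. map \<phi> (d' xs) = decode C v i (map (map \<phi>) xs))"
    if "v \<in> verts (dag N)" "i \<in> demands N v" for v i
    using lin that linear_fun_lift[of "input_dims N k n v" "k i" "decode C v i"]
    unfolding is_linear_code_def by metis
  then obtain d' where d': "\<And>v i. v \<in> verts (dag N) \<Longrightarrow> i \<in> demands N v \<Longrightarrow>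
      linear_fun S H (input_dims N k n v) (k i) (d' v i)
      \<and> d' v i \<in> ?in v \<rightarrow> words (carrier H) (k i)
      \<and> (\<forall>xs \<in> ?in v. map \<phi> (d' v i xs) = decode C v i (map (map \<phi>) xs))"
    by metis
  define C' where "C' = \<lparr>edge_fun = f', decode = d'\<rparr>"
  have code: "is_code N (carrier H) k n C'"
    using f' d' H lin by (simp add: C'_def is_code_def is_linear_code_def input_space_def)
  then have "is_linear_code N S H k n C'"
    using f' d' by (simp add: C'_def is_linear_code_def)
  moreover have "decode C' v i (inputs N x (carried N C' x) v) = x i"
    if x: "\<forall>i<num_messages N. x i \<in> words (carrier H) (k i)"
      and v: "v \<in> verts (dag N)" and i: "i \<in> demands N v" for x v i
  proof -
    let ?c = "carried N C' x" and ?y = "\<lambda>i. map \<phi> (x i)"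
    \<comment> \<open>Finiteness guarantees that \<open>sorted_list_of_set\<close> in
      \<open>in_edges\<close> lists exactly the incoming edges.\<close>
    have fin: "finite (in_arcs (dag N) v)" for v
      by (rule finite_subset[OF _ finite_arcs]) (auto simp: in_arcs_def)
    \<comment> \<open>Stated for an arbitrary node, to serve both the tail of an edge in the
      induction below and the receiver \<open>v\<close> afterwards.\<close>
    have inputs: "inputs N x ?c u \<in> ?in u \<and>
        map (map \<phi>) (inputs N x ?c u) = inputs N ?y (carried N C ?y) u"
      if "\<And>e. e \<in> in_arcs (dag N) u \<Longrightarrow>
        ?c e \<in> words (carrier H) n \<and> map \<phi> (?c e) = carried N C ?y e" for u
      using that x fin[of u]
      by (auto simp: listset_iff input_dims_def inputs_def in_edges_def messages_at_def
          list_all2_map1 list_all2_map2 intro!: list_all2_appendI list.rel_refl_strong)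
    \<comment> \<open>The induction follows the order of transmission. Membership in
      \<open>words\<close> is proved along with the commutation because \<open>f'\<close> agrees
      with the given code only on inputs over \<open>H\<close>.\<close>
    have carried: "?c e \<in> words (carrier H) n \<and> map \<phi> (?c e) = carried N C ?y e"
      if "e \<in> arcs (dag N)" for e
      using wf_edge_prec that
    proof (induction e rule: wf_induct_rule)
      case (less e)
      let ?u = "tail (dag N) e"
      have "inputs N x ?c ?u \<in> ?in ?u \<and>
          map (map \<phi>) (inputs N x ?c ?u) = inputs N ?y (carried N C ?y) ?u"
        by (intro inputs less.IH) (use less.prems in \<open>auto simp: edge_prec_def\<close>)
      moreover have "?c e = f' e (inputs N x ?c ?u)"
        using less.prems by (simp add: carried_eq C'_def)
      moreover have "carried N C ?y e = edge_fun C e (inputs N ?y (carried N C ?y) ?u)"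
        using less.prems by (rule carried_eq)
      ultimately show ?case
        using f'[OF less.prems] by fastforce
    qed
    have in_v: "inputs N x ?c v \<in> ?in v"
        "map (map \<phi>) (inputs N x ?c v) = inputs N ?y (carried N C ?y) v"
      using inputs[of v] carried by auto
    have im: "i < num_messages N"
      using demands v i by blast
    have "map \<phi> (decode C' v i (inputs N x ?c v)) = decode C v i (inputs N ?y (carried N C ?y) v)"
      using d'[OF v i] in_v by (simp add: C'_def)
    \<comment> \<open>The messages \<open>?y\<close> are words over \<open>G\<close>, so correctness
      of \<open>C\<close> applies to them.\<close>
    also have "\<dots> = map \<phi> (x i)"
      using C x v i map_words by (simp add: is_solution_def)
    finally have "map \<phi> (decode C' v i (inputs N x ?c v)) = map \<phi> (x i)" .
    moreover have "decode C' v i (inputs N x ?c v) \<in> words (carrier H) (k i)"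
      using d'[OF v i] in_v by (auto simp: C'_def)
    \<comment> \<open>To cancel \<open>map \<phi>\<close>, \<open>\<phi>\<close> has to be injective
      on the entries of both lists; these lie in \<open>carrier H\<close>, for \<open>x i\<close>
      because a demanded message is in range.\<close>
    then have "set (decode C' v i (inputs N x ?c v)) \<union> set (x i) \<subseteq> carrier H"
      using x im by (auto simp: words_def)
    then have "inj_on \<phi> (set (decode C' v i (inputs N x ?c v)) \<union> set (x i))"
      by (rule inj_on_subset[OF inj])
    ultimately show ?thesis
      by (simp add: inj_on_map_eq_map)
  qed
  ultimately show ?thesis
    using code by (auto simp: has_linear_solution_def is_solution_def)
qed

end

section \<open>Finite modules over a field\<close>

lemma additive_abelian_group_hom:
  assumes "abelian_group A" "abelian_group B"
    and "\<And>x. x \<in> carrier A \<Longrightarrow> h x \<in> carrier B"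
    and "\<And>x y. \<lbrakk>x \<in> carrier A; y \<in> carrier A\<rbrakk> \<Longrightarrow> h (x \<oplus>\<^bsub>A\<^esub> y) = h x \<oplus>\<^bsub>B\<^esub> h y"
  shows "abelian_group_hom A B h"
  using assms
  by (intro abelian_group_homI group_hom.intro group_hom_axioms.intro)
    (auto simp: hom_def abelian_group.a_group)

lemma (in abelian_group_hom) inj_on_zero_iff:
  "inj_on h (carrier G) \<longleftrightarrow> (\<forall>x\<in>carrier G. h x = \<zero>\<^bsub>H\<^esub> \<longrightarrow> x = \<zero>\<^bsub>G\<^esub>)"
  using group_hom.inj_on_one_iff[OF a_group_hom] by auto

lemma (in abelian_group_hom) hom_add_pow:
  "x \<in> carrier G \<Longrightarrow> h ([(n::nat)] \<cdot>\<^bsub>G\<^esub> x) = [n] \<cdot>\<^bsub>H\<^esub> h x"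
  by (induction n) (auto simp: G.add.nat_pow_Suc H.add.nat_pow_Suc)

text \<open>Together with \<open>scalar_hom\<close>, this yields the rules for zero, negatives and
  finite sums under scalar multiplication as instances of homomorphism facts.\<close>

lemma (in left_module) smult_hom:
  "a \<in> carrier R \<Longrightarrow> abelian_group_hom M M (\<lambda>x. a \<odot>\<^bsub>M\<^esub> x)"
  by (rule additive_abelian_group_hom)
    (auto simp: smult_r_distr intro: M.abelian_group_axioms)

lemma (in left_module) scalar_hom:
  "x \<in> carrier M \<Longrightarrow> abelian_group_hom R M (\<lambda>a. a \<odot>\<^bsub>M\<^esub> x)"
  by (rule additive_abelian_group_hom)
    (auto simp: smult_l_distr intro: M.abelian_group_axioms R.abelian_group_axioms)

section \<open>Linear combinations in coordinates\<close>

locale field_module = F: field F + V: left_module F V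
  for F :: "('a, 'x) ring_scheme" (structure) and V :: "('a, 'v, 'm) module_scheme" (structure)
begin

text \<open>Only the values of \<open>g\<close> below \<open>t\<close> matter, so a family is
  enlarged by \<open>g(t := v)\<close>. Taking coefficients from \<open>column_module\<close> makes
  this the coordinate map that later serves as \<open>\<phi>\<close>.\<close>

definition lincomb :: "nat \<Rightarrow> (nat \<Rightarrow> 'v) \<Rightarrow> 'a vec \<Rightarrow> 'v" where
  "lincomb t g x = (\<Oplus>\<^bsub>V\<^esub>i\<in>{..<t}. x $ i \<odot>\<^bsub>V\<^esub> g i)"

lemma lincomb_closed:
  assumes "g \<in> {..<t} \<rightarrow> carrier V" "x \<in> carrier (column_module F t)"
  shows "lincomb t g x \<in> carrier V"
  unfolding lincomb_def using assms
  by (intro V.M.finsum_closed) (auto simp: F.column_module_carrier_iff Pi_iff)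

lemma lincomb_hom:
  assumes "g \<in> {..<t} \<rightarrow> carrier V"
  shows "abelian_group_hom (column_module F t) V (lincomb t g)"
proof (rule additive_abelian_group_hom)
  show "abelian_group (column_module F t)"
    using F.left_module_column_module left_module.axioms(2) by blast
  fix x y assume "x \<in> carrier (column_module F t)" "y \<in> carrier (column_module F t)"
  then have xy: "x $ i \<in> carrier F" "y $ i \<in> carrier F" if "i < t" for i
    using that by (auto simp: F.column_module_carrier_iff)
  have "lincomb t g (x \<oplus>\<^bsub>column_module F t\<^esub> y) =
      (\<Oplus>\<^bsub>V\<^esub>i\<in>{..<t}. x $ i \<odot>\<^bsub>V\<^esub> g i \<oplus>\<^bsub>V\<^esub> y $ i \<odot>\<^bsub>V\<^esub> g i)"
    unfolding lincomb_def using assms xy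
    by (intro V.M.finsum_cong') (auto simp: F.column_module_ops V.smult_l_distr Pi_iff)
  also have "\<dots> = lincomb t g x \<oplus>\<^bsub>V\<^esub> lincomb t g y"
    unfolding lincomb_def using assms xy by (intro V.M.finsum_addf) auto
  finally show "lincomb t g (x \<oplus>\<^bsub>column_module F t\<^esub> y) = lincomb t g x \<oplus>\<^bsub>V\<^esub> lincomb t g y" .
qed (auto simp: assms lincomb_closed intro: V.M.abelian_group_axioms)

lemma lincomb_scale:
  assumes "g \<in> {..<t} \<rightarrow> carrier V" "x \<in> carrier (column_module F t)" "a \<in> carrier F"
  shows "lincomb t g (vec t (\<lambda>i. a \<otimes>\<^bsub>F\<^esub> x $ i)) = a \<odot>\<^bsub>V\<^esub> lincomb t g x"
  unfolding lincomb_def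
  by (subst abelian_group_hom.hom_finsum[OF V.smult_hom])
    (use assms in \<open>auto simp: F.column_module_carrier_iff V.smult_assoc1 Pi_iff intro!: V.M.finsum_cong'\<close>)

lemma lincomb_unit:
  assumes "g \<in> {..<t} \<rightarrow> carrier V" "i < t"
  shows "lincomb t g (vec t (\<lambda>j. if i = j then \<one>\<^bsub>F\<^esub> else \<zero>\<^bsub>F\<^esub>)) = g i"
proof -
  have "lincomb t g (vec t (\<lambda>j. if i = j then \<one>\<^bsub>F\<^esub> else \<zero>\<^bsub>F\<^esub>)) =
      (\<Oplus>\<^bsub>V\<^esub>j\<in>{..<t}. if i = j then g j else \<zero>\<^bsub>V\<^esub>)"
    unfolding lincomb_def using assms
    by (intro V.M.finsum_cong') (auto simp: abelian_group_hom.hom_zero[OF V.scalar_hom] Pi_iff)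
  also have "\<dots> = g i"
    using assms by (intro V.M.finsum_singleton) auto
  finally show ?thesis .
qed

lemma lincomb_extend:
  assumes "g \<in> {..<t} \<rightarrow> carrier V" "v \<in> carrier V" "x \<in> carrier (column_module F (Suc t))"
  shows "lincomb (Suc t) (g(t := v)) x = x $ t \<odot>\<^bsub>V\<^esub> v \<oplus>\<^bsub>V\<^esub> lincomb t g (vec t (\<lambda>i. x $ i))"
proof -
  have "lincomb (Suc t) (g(t := v)) x =
      x $ t \<odot>\<^bsub>V\<^esub> v \<oplus>\<^bsub>V\<^esub> (\<Oplus>\<^bsub>V\<^esub>i\<in>{..<t}. x $ i \<odot>\<^bsub>V\<^esub> (g(t := v)) i)"
    unfolding lincomb_def lessThan_Suc using assms
    by (subst V.M.finsum_insert) (auto simp: F.column_module_carrier_iff Pi_iff)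
  also have "(\<Oplus>\<^bsub>V\<^esub>i\<in>{..<t}. x $ i \<odot>\<^bsub>V\<^esub> (g(t := v)) i) = lincomb t g (vec t (\<lambda>i. x $ i))"
    unfolding lincomb_def using assms
    by (intro V.M.finsum_cong') (auto simp: F.column_module_carrier_iff Pi_iff)
  finally show ?thesis .
qed

section \<open>Independent families and bases\<close>

definition independent :: "nat \<Rightarrow> (nat \<Rightarrow> 'v) \<Rightarrow> bool" where
  "independent t g \<longleftrightarrow> g \<in> {..<t} \<rightarrow> carrier V \<and>
     inj_on (lincomb t g) (carrier (column_module F t))"

text \<open>Injectivity of an additive map means trivial kernel. The injective form supplies the
  bijection of \<open>exists_basis\<close>; this form is the one to check when a family is
  enlarged.\<close>

lemma independent_iff:
  "independent t g \<longleftrightarrow> g \<in> {..<t} \<rightarrow> carrier V \<and>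
     (\<forall>x\<in>carrier (column_module F t). lincomb t g x = \<zero>\<^bsub>V\<^esub> \<longrightarrow> x = vec t (\<lambda>_. \<zero>\<^bsub>F\<^esub>))"
  using abelian_group_hom.inj_on_zero_iff[OF lincomb_hom]
  by (auto simp: independent_def F.column_module_ops)

text \<open>Unit coordinate vectors have distinct images, so the members of the family are distinct.
  The bound is crude, but it ensures that a longest independent family exists.\<close>

lemma independent_card:
  assumes "finite (carrier V)" "independent t g"
  shows "t \<le> card (carrier V)"
proof -
  have g: "g \<in> {..<t} \<rightarrow> carrier V" and inj: "inj_on (lincomb t g) (carrier (column_module F t))"
    using assms by (auto simp: independent_def)
  let ?e = "\<lambda>i. vec t (\<lambda>j. if i = j then \<one>\<^bsub>F\<^esub> else \<zero>\<^bsub>F\<^esub>)"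
  have "inj_on g {..<t}"
  proof (rule inj_onI)
    fix i j assume ij: "i \<in> {..<t}" "j \<in> {..<t}" "g i = g j"
    then have "lincomb t g (?e i) = lincomb t g (?e j)"
      using g by (simp add: lincomb_unit)
    then have "?e i = ?e j"
      by (rule inj_onD[OF inj]) (auto simp: F.column_module_carrier_iff)
    \<comment> \<open>If \<open>i\<close> and \<open>j\<close> differed, this entry would be one on
      the left and zero on the right.\<close>
    then have "?e i $ i = ?e j $ i" by simp
    then show "i = j"
      using ij by (auto split: if_splits)
  qed
  then show ?thesis
    using card_inj_on_le[of g "{..<t}" "carrier V"] assms(1) g by auto
qed

text \<open>A relation with nonzero coefficient at \<open>v\<close> could be solved for
  \<open>v\<close>, which would put \<open>v\<close> into the span. So that coefficient vanishes,
  and a relation of the old family remains.\<close>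

lemma independent_extend:
  assumes "independent t g" "v \<in> carrier V"
    and v: "v \<notin> lincomb t g ` carrier (column_module F t)"
  shows "independent (Suc t) (g(t := v))"
  unfolding independent_iff
proof (intro conjI ballI impI)
  have g: "g \<in> {..<t} \<rightarrow> carrier V"
    using assms by (simp add: independent_iff)
  show "g(t := v) \<in> {..<Suc t} \<rightarrow> carrier V"
    using g assms(2) by (auto simp: less_Suc_eq)
  fix x assume x: "x \<in> carrier (column_module F (Suc t))"
    and zero: "lincomb (Suc t) (g(t := v)) x = \<zero>\<^bsub>V\<^esub>"
  let ?y = "vec t (\<lambda>i. x $ i)"
  have xt: "x $ t \<in> carrier F" and y: "?y \<in> carrier (column_module F t)"
    using x by (auto simp: F.column_module_carrier_iff)
  have sum: "x $ t \<odot>\<^bsub>V\<^esub> v \<oplus>\<^bsub>V\<^esub> lincomb t g ?y = \<zero>\<^bsub>V\<^esub>"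
    using zero lincomb_extend[OF g assms(2) x] by simp
  have xt0: "x $ t = \<zero>\<^bsub>F\<^esub>"
  proof (rule ccontr)
    assume "x $ t \<noteq> \<zero>\<^bsub>F\<^esub>"
    then have unit: "x $ t \<in> Units F"
      using xt by (simp add: F.field_Units)
    \<comment> \<open>Multiplying the relation by this scalar turns the coefficient of
      \<open>v\<close> into minus one.\<close>
    let ?b = "\<ominus>\<^bsub>F\<^esub> (inv\<^bsub>F\<^esub> (x $ t))"
    have b: "?b \<in> carrier F"
      using unit by simp
    have bx: "?b \<otimes>\<^bsub>F\<^esub> x $ t = \<ominus>\<^bsub>F\<^esub> \<one>\<^bsub>F\<^esub>"
      using unit xt by (simp add: F.l_minus)
    have "\<zero>\<^bsub>V\<^esub> = ?b \<odot>\<^bsub>V\<^esub> (x $ t \<odot>\<^bsub>V\<^esub> v \<oplus>\<^bsub>V\<^esub> lincomb t g ?y)"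
      unfolding sum using abelian_group_hom.hom_zero[OF V.smult_hom[OF b]] by simp
    also have "\<dots> = (\<ominus>\<^bsub>F\<^esub> \<one>\<^bsub>F\<^esub>) \<odot>\<^bsub>V\<^esub> v \<oplus>\<^bsub>V\<^esub> ?b \<odot>\<^bsub>V\<^esub> lincomb t g ?y"
      using b xt y g assms(2)
      by (simp add: V.smult_r_distr lincomb_closed flip: V.smult_assoc1 bx)
    also have "(\<ominus>\<^bsub>F\<^esub> \<one>\<^bsub>F\<^esub>) \<odot>\<^bsub>V\<^esub> v = \<ominus>\<^bsub>V\<^esub> v"
      using abelian_group_hom.hom_a_inv[OF V.scalar_hom[OF assms(2)], of "\<one>\<^bsub>F\<^esub>"] assms(2) by simp
    finally have "v = ?b \<odot>\<^bsub>V\<^esub> lincomb t g ?y"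
      using assms(2) b y g lincomb_closed[OF g y]
      by (metis V.M.minus_equality V.M.minus_minus V.smult_closed V.M.a_comm V.M.a_inv_closed)
    also have "\<dots> = lincomb t g (vec t (\<lambda>i. ?b \<otimes>\<^bsub>F\<^esub> ?y $ i))"
      using lincomb_scale[OF g y b] by simp
    finally have "v \<in> lincomb t g ` carrier (column_module F t)"
      by (rule image_eqI) (use b y in \<open>auto simp: F.column_module_carrier_iff\<close>)
    with v show False by simp
  qed
  then have "lincomb t g ?y = \<zero>\<^bsub>V\<^esub>"
    using sum g y assms(2) by (simp add: abelian_group_hom.hom_zero[OF V.scalar_hom] lincomb_closed)
  then have "?y = vec t (\<lambda>_. \<zero>\<^bsub>F\<^esub>)"
    using assms(1) y by (simp add: independent_iff)
  then have "x $ i = \<zero>\<^bsub>F\<^esub>" if "i < t" for i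
    using that by (metis index_vec)
  with xt0 have "x $ i = \<zero>\<^bsub>F\<^esub>" if "i < Suc t" for i
    using that by (auto simp: less_Suc_eq)
  then show "x = vec (Suc t) (\<lambda>_. \<zero>\<^bsub>F\<^esub>)"
    using x by (intro eq_vecI) (auto simp: F.column_module_carrier_iff)
qed

text \<open>A longest independent family spans, since any vector outside its span could be
  adjoined.\<close>

lemma exists_basis:
  assumes "finite (carrier V)"
  obtains t g where "g \<in> {..<t} \<rightarrow> carrier V"
    and "bij_betw (lincomb t g) (carrier (column_module F t)) (carrier V)"
proof -
  \<comment> \<open>The empty family starts the search: there is only one coordinate vector of
    dimension zero.\<close>
  have "independent 0 (\<lambda>_. \<zero>\<^bsub>V\<^esub>)"
    by (auto simp: independent_iff F.column_module_carrier_iff)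
  then have "\<exists>t. (\<exists>g. independent t g) \<and> (\<forall>s. (\<exists>g. independent s g) \<longrightarrow> s \<le> t)"
    using independent_card[OF assms]
    by (intro Nat.ex_has_greatest_nat[of _ 0 "card (carrier V)"]) auto
  then obtain t g where g: "independent t g" and max: "\<And>s h. independent s h \<Longrightarrow> s \<le> t"
    by auto
  have "v \<in> lincomb t g ` carrier (column_module F t)" if "v \<in> carrier V" for v
    using independent_extend[OF g that] max[of "Suc t"] by auto
  then show thesis
    using g by (intro that[of g t]) (auto simp: independent_def bij_betw_def lincomb_closed)
qed

text \<open>Column \<open>j\<close> of the matrix holds coordinates of \<open>f (g j)\<close>,
  available because the family spans. Linearity of \<open>f\<close> extends the agreement from the
  \<open>g j\<close> to all combinations.\<close>

lemma endomorphism_matrix: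
  assumes g: "g \<in> {..<t} \<rightarrow> carrier V"
    and surj: "lincomb t g ` carrier (column_module F t) = carrier V"
    and f: "abelian_group_hom V V f"
    and scale: "\<And>a x. \<lbrakk>a \<in> carrier F; x \<in> carrier V\<rbrakk> \<Longrightarrow> f (a \<odot>\<^bsub>V\<^esub> x) = a \<odot>\<^bsub>V\<^esub> f x"
  obtains A where "A \<in> carrier (matrix_ring F t)"
    and "\<And>x. x \<in> carrier (column_module F t) \<Longrightarrow>
      lincomb t g (A \<odot>\<^bsub>column_module F t\<^esub> x) = f (lincomb t g x)"
proof -
  interpret f: abelian_group_hom V V f by fact
  have g': "g j \<in> carrier V" if "j < t" for j
    using g that by auto
  have "\<exists>c. c \<in> carrier (column_module F t) \<and> lincomb t g c = f (g j)" if "j < t" for j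
    using surj g'[OF that] f.hom_closed by (metis imageE)
  then obtain c where c: "\<And>j. j < t \<Longrightarrow> c j \<in> carrier (column_module F t)"
      and fc: "\<And>j. j < t \<Longrightarrow> lincomb t g (c j) = f (g j)"
    by metis
  have c': "c j $ i \<in> carrier F" if "i < t" "j < t" for i j
    using c that by (auto simp: F.column_module_carrier_iff)
  let ?A = "mat t t (\<lambda>(i, j). c j $ i)"
  show thesis
  proof
    show "?A \<in> carrier (matrix_ring F t)"
      by (auto simp: F.matrix_ring_carrier_iff c')
    fix x assume "x \<in> carrier (column_module F t)"
    then have x: "x $ j \<in> carrier F" if "j < t" for j
      using that by (auto simp: F.column_module_carrier_iff)
    \<comment> \<open>Commutativity of \<open>F\<close> moves \<open>x $ j\<close> to the front, so
      that after the exchange of the two sums it can be drawn into \<open>f\<close> by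
      \<open>scale\<close>.\<close>
    have "lincomb t g (?A \<odot>\<^bsub>column_module F t\<^esub> x) =
        (\<Oplus>\<^bsub>V\<^esub>i\<in>{..<t}. (\<Oplus>\<^bsub>F\<^esub>j\<in>{..<t}. x $ j \<otimes>\<^bsub>F\<^esub> c j $ i) \<odot>\<^bsub>V\<^esub> g i)"
      unfolding lincomb_def
      by (intro V.M.finsum_cong' arg_cong[where f = "\<lambda>a. a \<odot>\<^bsub>V\<^esub> _"])
        (auto simp: F.column_module_ops x c' g' F.m_comm intro!: F.finsum_cong' V.smult_closed F.finsum_closed)
    also have "\<dots> = (\<Oplus>\<^bsub>V\<^esub>i\<in>{..<t}. \<Oplus>\<^bsub>V\<^esub>j\<in>{..<t}. x $ j \<odot>\<^bsub>V\<^esub> (c j $ i \<odot>\<^bsub>V\<^esub> g i))"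
      by (intro V.M.finsum_cong')
        (auto simp: abelian_group_hom.hom_finsum[OF V.scalar_hom] V.smult_assoc1 Pi_iff x c' g'
          intro!: V.M.finsum_cong' V.M.finsum_closed)
    also have "\<dots> = (\<Oplus>\<^bsub>V\<^esub>j\<in>{..<t}. \<Oplus>\<^bsub>V\<^esub>i\<in>{..<t}. x $ j \<odot>\<^bsub>V\<^esub> (c j $ i \<odot>\<^bsub>V\<^esub> g i))"
      by (intro V.M.add.finprod_finprod_swap) (auto simp: x c' g')
    also have "\<dots> = (\<Oplus>\<^bsub>V\<^esub>j\<in>{..<t}. x $ j \<odot>\<^bsub>V\<^esub> lincomb t g (c j))"
      unfolding lincomb_def
      by (intro V.M.finsum_cong')
        (auto simp: abelian_group_hom.hom_finsum[OF V.smult_hom] Pi_iff x c' g' intro!: V.smult_closed V.M.finsum_closed)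
    also have "\<dots> = (\<Oplus>\<^bsub>V\<^esub>j\<in>{..<t}. f (x $ j \<odot>\<^bsub>V\<^esub> g j))"
      by (intro V.M.finsum_cong') (auto simp: fc scale x g')
    also have "\<dots> = f (lincomb t g x)"
      unfolding lincomb_def by (rule f.hom_finsum[symmetric]) (auto simp: x g')
    finally show "lincomb t g (?A \<odot>\<^bsub>column_module F t\<^esub> x) = f (lincomb t g x)" .
  qed
qed

end

section \<open>The torsion submodule\<close>

text \<open>Sylow's theorem with exponent one gives a subgroup of order \<open>p\<close>. Any
  element of it other than the identity will do, by Lagrange's theorem inside that subgroup.\<close>

lemma (in group) cauchy:
  assumes "finite (carrier G)" "prime p" "p dvd order G"
  obtains x where "x \<in> carrier G" "x \<noteq> \<one>" "x [^] p = \<one>"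
proof -
  from assms(3) obtain m where "order G = p ^ 1 * m"
    by (auto elim: dvdE)
  then obtain H where H: "subgroup H G" "card H = p ^ 1"
    using sylow_thm assms group_axioms by blast
  interpret H: subgroup H G by fact
  interpret HG: group "G\<lparr>carrier := H\<rparr>"
    by (rule subgroup.subgroup_is_group[OF H(1) group_axioms])
  have "\<not> H \<subseteq> {\<one>}"
    using H(2) prime_gt_1_nat[OF assms(2)] card_mono[of "{\<one>}" H] by auto
  then obtain x where x: "x \<in> H" "x \<noteq> \<one>" by auto
  have "x [^]\<^bsub>G\<lparr>carrier := H\<rparr>\<^esub> order (G\<lparr>carrier := H\<rparr>) = \<one>"
    using HG.pow_order_eq_1[of x] x by simp
  then have "x [^] p = \<one>"
    using H(2) by (simp add: order_def flip: nat_pow_consistent)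
  then show thesis
    using x H.mem_carrier that by blast
qed

text \<open>Residues are represented by natural numbers, so that a field element can be used
  directly as a multiplier in \<open>torsion_module\<close>. The unreduced \<open>1\<close> is a
  residue because \<open>p > 1\<close>.\<close>

definition prime_field :: "nat \<Rightarrow> nat ring" where
  "prime_field p =
    \<lparr>carrier = {..<p}, monoid.mult = (\<lambda>a b. a * b mod p), one = 1, zero = 0,
     add = (\<lambda>a b. (a + b) mod p)\<rparr>"

lemma field_prime_field:
  assumes "prime p"
  shows "field (prime_field p)"
proof -
  have p: "p > 1" using assms by (rule prime_gt_1_nat)
  interpret cring "prime_field p"
  proof (rule cringI)
    show "abelian_group (prime_field p)"
    proof (rule abelian_groupI)
      fix a assume "a \<in> carrier (prime_field p)"
      then show "\<exists>b\<in>carrier (prime_field p). b \<oplus>\<^bsub>prime_field p\<^esub> a = \<zero>\<^bsub>prime_field p\<^esub>"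
        \<comment> \<open>The outer reduction covers \<open>a = 0\<close>, where
          \<open>p - a\<close> lies outside the carrier.\<close>
        using p by (intro bexI[of _ "(p - a) mod p"]) (auto simp: prime_field_def mod_simps)
    qed (use p in \<open>auto simp: prime_field_def mod_simps ac_simps\<close>)
    show "comm_monoid (prime_field p)"
      by (rule comm_monoidI) (use p in \<open>auto simp: prime_field_def mod_simps ac_simps\<close>)
  qed (auto simp: prime_field_def mod_simps algebra_simps)
  show ?thesis
  proof (rule cring_fieldI2)
    fix a assume "a \<in> carrier (prime_field p)" "a \<noteq> \<zero>\<^bsub>prime_field p\<^esub>"
    then have "0 < a" "a < p" by (auto simp: prime_field_def)
    then have "coprime a p"
      using assms by (metis coprime_commute nat_dvd_not_less prime_imp_coprime)
    then obtain b where "[a * b = 1] (mod p)"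
      using cong_solve_coprime_nat by auto
    then show "\<exists>b\<in>carrier (prime_field p). a \<otimes>\<^bsub>prime_field p\<^esub> b = \<one>\<^bsub>prime_field p\<^esub>"
      using p by (intro bexI[of _ "b mod p"]) (auto simp: prime_field_def cong_def mod_simps)
  qed (simp add: prime_field_def)
qed

text \<open>The \<open>n\<close>-fold sum of one is \<open>n mod p\<close>, which vanishes exactly
  for multiples of \<open>p\<close>.\<close>

lemma ring_char_prime_field:
  assumes "prime p"
  shows "ring_char (prime_field p) = p"
proof -
  have p: "p > 1" using assms by (rule prime_gt_1_nat)
  interpret field "prime_field p"
    using assms by (rule field_prime_field)
  have pow: "[n] \<cdot>\<^bsub>prime_field p\<^esub> \<one>\<^bsub>prime_field p\<^esub> = n mod p" for n :: nat
    by (induction n) (auto simp: add.nat_pow_Suc, auto simp: prime_field_def mod_simps)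
  show ?thesis
    unfolding ring_char_def
    by (subst add.ord_unique) (auto simp: pow, auto simp: prime_field_def mod_eq_0_iff_dvd)
qed

text \<open>The scalars are those of the prime field; the action of \<open>R\<close> returns later
  as a family of endomorphisms of this module.\<close>

definition torsion_module :: "nat \<Rightarrow> ('r, 'g, 'm) module_scheme \<Rightarrow> (nat, 'g) module" where
  "torsion_module p G =
    \<lparr>carrier = {x \<in> carrier G. [p] \<cdot>\<^bsub>G\<^esub> x = \<zero>\<^bsub>G\<^esub>}, monoid.mult = undefined, one = undefined,
     zero = \<zero>\<^bsub>G\<^esub>, add = add G, smult = (\<lambda>a x. [a] \<cdot>\<^bsub>G\<^esub> x)\<rparr>"

text \<open>Since \<open>p\<close> annihilates the carrier, a multiple depends only on its
  multiplier modulo \<open>p\<close> (\<open>pow_mod\<close>). Hence arithmetic with residues agrees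
  with repeated addition.\<close>

lemma left_module_torsion_module:
  assumes "abelian_group G" "prime p"
  shows "left_module (prime_field p) (torsion_module p G)"
proof -
  interpret abelian_group G by fact
  have pow_mod: "[(n mod p)] \<cdot>\<^bsub>G\<^esub> x = [n] \<cdot>\<^bsub>G\<^esub> x"
    if "x \<in> carrier G" "[p] \<cdot>\<^bsub>G\<^esub> x = \<zero>\<^bsub>G\<^esub>" for n :: nat and x
  proof -
    have "[n] \<cdot>\<^bsub>G\<^esub> x = [(p * (n div p))] \<cdot>\<^bsub>G\<^esub> x \<oplus>\<^bsub>G\<^esub> [(n mod p)] \<cdot>\<^bsub>G\<^esub> x"
      using that by (simp add: add.nat_pow_mult)
    also have "[(p * (n div p))] \<cdot>\<^bsub>G\<^esub> x = \<zero>\<^bsub>G\<^esub>"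
      using that add.nat_pow_pow[of x "n div p" p] by simp
    finally show ?thesis using that by simp
  qed
  have distr: "[n] \<cdot>\<^bsub>G\<^esub> (x \<oplus>\<^bsub>G\<^esub> y) = [n] \<cdot>\<^bsub>G\<^esub> x \<oplus>\<^bsub>G\<^esub> [n] \<cdot>\<^bsub>G\<^esub> y"
    if "x \<in> carrier G" "y \<in> carrier G" for n :: nat and x y
    using that by (simp add: add.pow_mult_distrib a_comm)
  have inv: "[n] \<cdot>\<^bsub>G\<^esub> (\<ominus>\<^bsub>G\<^esub> x) = \<ominus>\<^bsub>G\<^esub> ([n] \<cdot>\<^bsub>G\<^esub> x)" if "x \<in> carrier G" for n :: nat and x
    using that by (rule add.nat_pow_inv)
  \<comment> \<open>Gives closure under scalars: a multiple of a torsion element is again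
    annihilated by \<open>p\<close>.\<close>
  have nat_pow_p: "[(n * p)] \<cdot>\<^bsub>G\<^esub> x = \<zero>\<^bsub>G\<^esub>"
    if "x \<in> carrier G" "[p] \<cdot>\<^bsub>G\<^esub> x = \<zero>\<^bsub>G\<^esub>" for n :: nat and x
    using that add.nat_pow_pow[of x n p] by (simp add: mult.commute)
  have "abelian_group (torsion_module p G)"
  proof (rule abelian_groupI)
    fix x assume "x \<in> carrier (torsion_module p G)"
    then show "\<exists>y\<in>carrier (torsion_module p G). y \<oplus>\<^bsub>torsion_module p G\<^esub> x = \<zero>\<^bsub>torsion_module p G\<^esub>"
      by (intro bexI[of _ "\<ominus>\<^bsub>G\<^esub> x"]) (auto simp: torsion_module_def l_neg inv)
  qed (auto simp: torsion_module_def distr a_assoc intro: a_comm)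
  moreover have "ring (prime_field p)"
    using field_prime_field[OF assms(2)] by (intro cring.axioms(1) domain.axioms(1) field.axioms(1))
  moreover have "left_module_axioms (prime_field p) (torsion_module p G)"
    by unfold_locales
      (auto simp: torsion_module_def prime_field_def distr pow_mod add.nat_pow_mult
        add.nat_pow_pow nat_pow_p mult.commute)
  ultimately show ?thesis
    by (intro left_module.intro)
qed

theorem lemma2p14:
  fixes R :: "('r, 'x) ring_scheme" and G :: "('r, 'g, 'm) module_scheme" and p :: nat
  assumes "left_module R G" and "finite (carrier G)"
    and "prime p" and "p dvd card (carrier G)"
  shows "\<exists>(F :: nat ring) t. field F \<and> finite (carrier F) \<and> ring_char F = p \<and> t \<ge> 1 \<and>
    fractionally_dominates (matrix_ring F t) (column_module F t) R G"
proof -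
  interpret G: left_module R G by fact
  let ?F = "prime_field p" and ?T = "torsion_module p G"
  have T_carrier: "carrier ?T \<subseteq> carrier G"
    by (auto simp: torsion_module_def)
  interpret field_module ?F ?T
    using G.M.abelian_group_axioms assms(3)
    by (intro field_module.intro field_prime_field left_module_torsion_module)
  have fin: "finite (carrier ?T)"
    using T_carrier assms(2) by (rule finite_subset)
  obtain t g where g: "g \<in> {..<t} \<rightarrow> carrier ?T"
    and bij: "bij_betw (lincomb t g) (carrier (column_module ?F t)) (carrier ?T)"
    using exists_basis[OF fin] by blast
  have "order (add_monoid G) = card (carrier G)"
    by (simp add: order_def)
  then obtain x where "x \<in> carrier G" "x \<noteq> \<zero>\<^bsub>G\<^esub>" "[p] \<cdot>\<^bsub>G\<^esub> x = \<zero>\<^bsub>G\<^esub>"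
    using G.M.add.cauchy assms by auto
  \<comment> \<open>Two torsion elements give an alphabet with at least two letters, as
    \<open>is_code\<close> demands.\<close>
  then have "{\<zero>\<^bsub>G\<^esub>, x} \<subseteq> carrier ?T" "card {\<zero>\<^bsub>G\<^esub>, x} = 2"
    by (auto simp: torsion_module_def)
  then have card2: "card (carrier (column_module ?F t)) \<ge> 2"
    using card_mono[OF fin] bij_betw_same_card[OF bij] by metis
  have t: "t \<ge> 1"
  proof (rule ccontr)
    assume "\<not> t \<ge> 1"
    \<comment> \<open>In dimension zero there would be only one vector, contradicting
      \<open>card2\<close>.\<close>
    then have "carrier (column_module ?F t) \<subseteq> {vec 0 (\<lambda>_. 0)}"
      by (auto simp: F.column_module_carrier_iff)
    then show False
      using card2 card_mono[of "{vec 0 (\<lambda>_. 0)}" "carrier (column_module ?F t)"] by auto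
  qed
  have "\<exists>A. A \<in> carrier (matrix_ring ?F t) \<and> (\<forall>x\<in>carrier (column_module ?F t).
      lincomb t g (A \<odot>\<^bsub>column_module ?F t\<^esub> x) = r \<odot>\<^bsub>G\<^esub> lincomb t g x)"
    if r: "r \<in> carrier R" for r
  proof -
    interpret r: abelian_group_hom G G "\<lambda>x. r \<odot>\<^bsub>G\<^esub> x"
      using r by (rule G.smult_hom)
    \<comment> \<open>Torsion is preserved because an additive map commutes with taking
      \<open>p\<close>-fold sums.\<close>
    have "abelian_group_hom ?T ?T (\<lambda>x. r \<odot>\<^bsub>G\<^esub> x)"
    proof (rule additive_abelian_group_hom[OF V.M.abelian_group_axioms V.M.abelian_group_axioms])
      show "r \<odot>\<^bsub>G\<^esub> x \<in> carrier ?T" if "x \<in> carrier ?T" for x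
        using that r r.hom_add_pow[of x p] r.hom_zero by (auto simp: torsion_module_def)
    qed (auto simp: torsion_module_def)
    \<comment> \<open>Scalars of the prime field act by repeated addition and so commute with every
      additive map. Thus each \<open>r\<close> acts linearly over the prime field, although
      \<open>R\<close> may be noncommutative.\<close>
    moreover have "r \<odot>\<^bsub>G\<^esub> (a \<odot>\<^bsub>?T\<^esub> x) = a \<odot>\<^bsub>?T\<^esub> (r \<odot>\<^bsub>G\<^esub> x)" if "x \<in> carrier ?T" for a x
      using that r.hom_add_pow by (auto simp: torsion_module_def)
    ultimately show ?thesis
      using endomorphism_matrix[OF g bij_betw_imp_surj_on[OF bij]] by metis
  qed
  then obtain \<rho> where rho: "\<And>r. r \<in> carrier R \<Longrightarrow> \<rho> r \<in> carrier (matrix_ring ?F t)"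
    "\<And>r x. r \<in> carrier R \<Longrightarrow> x \<in> carrier (column_module ?F t) \<Longrightarrow>
      lincomb t g (\<rho> r \<odot>\<^bsub>column_module ?F t\<^esub> x) = r \<odot>\<^bsub>G\<^esub> lincomb t g x"
    by metis
  interpret column: left_module "matrix_ring ?F t" "column_module ?F t"
    by (rule F.left_module_column_module)
  interpret phi: abelian_group_hom "column_module ?F t" ?T "lincomb t g"
    using g by (rule lincomb_hom)
  \<comment> \<open>The coordinate map followed by the inclusion of the torsion elements into
    \<open>G\<close> is the embedding \<open>\<phi>\<close>.\<close>
  have "abelian_group_hom (column_module ?F t) G (lincomb t g)"
  proof (rule additive_abelian_group_hom)
    show "lincomb t g x \<in> carrier G" if "x \<in> carrier (column_module ?F t)" for x
      using that phi.hom_closed T_carrier by blast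
    show "lincomb t g (x \<oplus>\<^bsub>column_module ?F t\<^esub> y) = lincomb t g x \<oplus>\<^bsub>G\<^esub> lincomb t g y"
      if "x \<in> carrier (column_module ?F t)" "y \<in> carrier (column_module ?F t)" for x y
      using phi.hom_add[OF that] by (simp add: torsion_module_def)
  qed (intro column.M.abelian_group_axioms G.M.abelian_group_axioms)+
  then interpret emb: module_embedding R G "matrix_ring ?F t" "column_module ?F t" "lincomb t g" \<rho>
    using rho bij
    by (intro module_embedding.intro module_embedding_axioms.intro G.left_module_axioms
        column.left_module_axioms) (auto simp: bij_betw_def)
  have "finite (carrier (column_module ?F t))"
    using bij fin bij_betw_finite by blast
  then have "fractionally_dominates (matrix_ring ?F t) (column_module ?F t) R G"
    unfolding fractionally_dominates_def using card2 emb.has_linear_solution_lift by blast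
  then show ?thesis
    using t F.field_axioms ring_char_prime_field[OF assms(3)]
    by (intro exI[of _ ?F] exI[of _ t]) (auto simp: prime_field_def)
qed

end
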